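(* Let $\alpha>1$ be a real number and define $\kappa:(1,\infty)\to\mathbb{R}$ by \[ \kappa(x)=\dim_H M_x=\frac{(1-x)\log(x-1)+x\log(x)}{-\log(\alpha-1)+x\log(\alpha)}. \] Then $\kappa$ is a positive, differentiable, unimodal function whose maximum is attained at $x=\alpha/(\alpha-1)$ with value $\kappa(\alpha/(\alpha-1))=1$, and \[ \lim_{x\to 1^+}\kappa(x)=\lim_{x\to \infty}\kappa(x)=0. \]
   Context: $\mathbb{N}=\{1,2,3,\dots\}$. Let $\alpha>1$ be real. It is known that every $x\in(0,1]$ can be uniquely written in the form $x=\sum_{i=1}^{\infty}(\alpha-1)^{i-1}\alpha^{-(d_{1}(x)+\dots+d_{i}(x))}$ with $(d_i(x))_{i\ge1}\in\mathbb{N}^{\mathbb{N}}$ (the $\alpha$-expansion of $x$). For $\beta>1$, $M_\beta=\{x\in(0,1] : \lim_{k\to\infty}\frac1k\sum_{i=1}^k d_i(x)=\beta\}$, and $\dim_H$ is Hausdorff dimension; the equality of $\dim_H M_x$ with the displayed quotient holds for all $x>1$, so $\kappa$ may be taken to be defined by the quotient. Unimodal means that there is a point $c\in(1,\infty)$ such that the function is strictly increasing on $(1,c]$ and strictly decreasing on $[c,\infty)$. *)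

theory Defs
  imports "HOL-Analysis.Analysis"
begin

(* The closed form of the Hausdorff dimension of the level set M_x of points of (0,1] whose
   alpha-expansion digits have arithmetic mean x; meaningful for \<alpha> > 1 and x > 1. *)
definition kappa :: "real \<Rightarrow> real \<Rightarrow> real" where
  "kappa \<alpha> x = ((1 - x) * ln (x - 1) + x * ln x) / (- ln (\<alpha> - 1) + x * ln \<alpha>)"

definition unimodal :: "(real \<Rightarrow> real) \<Rightarrow> bool" where
  "unimodal f \<longleftrightarrow> (\<exists>c>1. strict_mono_on {1<..c} f \<and> strict_antimono_on {c..} f)"

end

theory Submission
  imports Defs "HOL-Real_Asymp.Real_Asymp"
begin

text \<open>
  Write \<open>kappa \<alpha> = N / D\<close>, where \<open>N x = (1 - x) ln (x - 1) + x ln x\<close> and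
  \<open>D x = x ln \<alpha> - ln (\<alpha> - 1)\<close>. The digits of the \<open>\<alpha>\<close>-expansion of a Lebesgue-random point are
  geometric with parameter \<open>(\<alpha> - 1) / \<alpha>\<close>; \<open>N x\<close> is the entropy of the geometric law of
  mean \<open>x\<close>, and \<open>D x\<close> is its cross entropy relative to that digit law. Hence both are positive,
  and they agree where the two laws coincide, at \<open>x = \<alpha> / (\<alpha> - 1)\<close>.

  For the shape of the quotient, note that \<open>D\<close> is affine, so that in \<open>N' D - N D'\<close> all terms
  with a factor \<open>x\<close> outside a logarithm cancel. What is left,
  \<open>(ln (\<alpha> - 1) - ln \<alpha>) ln (x - 1) - ln (\<alpha> - 1) ln x\<close>, is strictly decreasing and vanishes at
  \<open>\<alpha> / (\<alpha> - 1)\<close>. Thus \<open>kappa \<alpha>\<close> strictly increases up to this point and strictly decreases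
  after it, which gives unimodality and the maximum together.

  At \<open>1\<close> the entropy tends to \<open>0\<close> while \<open>D\<close> has a positive limit; at infinity the entropy grows
  only logarithmically while \<open>D\<close> grows linearly.
\<close>

definition geometric_entropy :: "real \<Rightarrow> real" where
  "geometric_entropy x = (1 - x) * ln (x - 1) + x * ln x"

definition geometric_cross_entropy :: "real \<Rightarrow> real \<Rightarrow> real" where
  "geometric_cross_entropy \<alpha> x = - ln (\<alpha> - 1) + x * ln \<alpha>"

text \<open>The numerator of the derivative of \<^term>\<open>kappa \<alpha>\<close>, after the cancellation.\<close>

definition kappa_slope :: "real \<Rightarrow> real \<Rightarrow> real" where
  "kappa_slope \<alpha> x = (ln (\<alpha> - 1) - ln \<alpha>) * ln (x - 1) - ln (\<alpha> - 1) * ln x"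

lemma kappa_eq_entropy_quotient:
  "kappa \<alpha> x = geometric_entropy x / geometric_cross_entropy \<alpha> x"
  by (simp add: kappa_def geometric_entropy_def geometric_cross_entropy_def)

text \<open>
  The two terms of the entropy have opposite signs for large \<open>x\<close>; grouping the logarithms
  around \<^term>\<open>ln x - ln (x - 1)\<close> leaves only positive terms.
\<close>

lemma geometric_entropy_pos:
  assumes "x > 1"
  shows "geometric_entropy x > 0"
proof -
  have "geometric_entropy x = ln x + (x - 1) * (ln x - ln (x - 1))"
    by (simp add: geometric_entropy_def algebra_simps)
  moreover have "ln x > 0" "ln x - ln (x - 1) > 0"
    using assms by simp_all
  ultimately show ?thesis
    using assms by (simp add: add_pos_pos)
qed

lemma geometric_cross_entropy_pos:
  assumes "\<alpha> > 1" "x \<ge> 1"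
  shows "geometric_cross_entropy \<alpha> x > 0"
proof -
  have "ln (\<alpha> - 1) < ln \<alpha>" "ln \<alpha> \<le> x * ln \<alpha>"
    using assms by simp_all
  then show ?thesis
    by (simp add: geometric_cross_entropy_def)
qed

lemma kappa_pos:
  assumes "\<alpha> > 1" "x > 1"
  shows "kappa \<alpha> x > 0"
  using assms geometric_entropy_pos[of x] geometric_cross_entropy_pos[of \<alpha> x]
  by (simp add: kappa_eq_entropy_quotient)

lemma kappa_has_real_derivative:
  assumes "\<alpha> > 1" "x > 1"
  shows "(kappa \<alpha> has_real_derivative kappa_slope \<alpha> x / (geometric_cross_entropy \<alpha> x)\<^sup>2) (at x)"
proof -
  have D: "geometric_cross_entropy \<alpha> x \<noteq> 0"
    using geometric_cross_entropy_pos[of \<alpha> x] assms by simp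
  have N': "(geometric_entropy has_real_derivative ln x - ln (x - 1)) (at x)"
  proof -
    have "(geometric_entropy has_real_derivative
        - ln (x - 1) + (1 - x) / (x - 1) + (ln x + x / x)) (at x)"
      unfolding geometric_entropy_def[abs_def]
      using assms by (auto intro!: derivative_eq_intros)
    moreover have "(1 - x) / (x - 1) = - 1" "x / x = 1"
      using assms by (simp_all add: divide_eq_eq)
    ultimately show ?thesis
      by simp
  qed
  have D': "(geometric_cross_entropy \<alpha> has_real_derivative ln \<alpha>) (at x)"
    unfolding geometric_cross_entropy_def[abs_def]
    by (auto intro!: derivative_eq_intros)
  have "(ln x - ln (x - 1)) * geometric_cross_entropy \<alpha> x - geometric_entropy x * ln \<alpha>
      = kappa_slope \<alpha> x"
    by (simp add: geometric_cross_entropy_def geometric_entropy_def kappa_slope_def algebra_simps)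
  then show ?thesis
    using DERIV_divide[OF N' D' D]
    by (simp add: kappa_eq_entropy_quotient[abs_def] power2_eq_square)
qed

lemma continuous_on_kappa:
  assumes "\<alpha> > 1" "S \<subseteq> {1<..}"
  shows "continuous_on S (kappa \<alpha>)"
proof (rule DERIV_continuous_on)
  fix x assume "x \<in> S"
  with assms show "(kappa \<alpha> has_real_derivative
      kappa_slope \<alpha> x / (geometric_cross_entropy \<alpha> x)\<^sup>2) (at x within S)"
    by (intro has_field_derivative_at_within[OF kappa_has_real_derivative]) auto
qed

text \<open>
  The coefficient of \<^term>\<open>ln (x - 1)\<close> in the slope is negative, but the sign of
  \<^term>\<open>ln (\<alpha> - 1)\<close> depends on whether \<open>\<alpha> > 2\<close>. Over a common denominator the derivative of the
  slope is
  \<open>-(x ln \<alpha> - ln (\<alpha> - 1)) / (x (x - 1))\<close>, so its sign is that of the cross entropy, reversed,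
  and no case distinction arises.
\<close>

lemma kappa_slope_strict_antimono:
  assumes "\<alpha> > 1" "1 < x" "x < y"
  shows "kappa_slope \<alpha> y < kappa_slope \<alpha> x"
proof (rule DERIV_neg_imp_decreasing[OF \<open>x < y\<close>])
  fix t assume "x \<le> t" "t \<le> y"
  with assms have t: "t > 1" by simp
  have "(kappa_slope \<alpha> has_real_derivative
      (ln (\<alpha> - 1) - ln \<alpha>) / (t - 1) - ln (\<alpha> - 1) / t) (at t)"
    unfolding kappa_slope_def[abs_def] using t
    by (auto intro!: derivative_eq_intros)
  also have "(ln (\<alpha> - 1) - ln \<alpha>) / (t - 1) - ln (\<alpha> - 1) / t
      = - (geometric_cross_entropy \<alpha> t / (t * (t - 1)))"
    using t by (simp add: geometric_cross_entropy_def field_simps)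
  finally show "\<exists>d. (kappa_slope \<alpha> has_real_derivative d) (at t) \<and> d < 0"
    using geometric_cross_entropy_pos[of \<alpha> t] assms t
    by (intro exI[of _ "- (geometric_cross_entropy \<alpha> t / (t * (t - 1)))"]) simp
qed

lemma ln_peak:
  fixes \<alpha> :: real
  assumes "\<alpha> > 1"
  shows "ln (\<alpha> / (\<alpha> - 1) - 1) = - ln (\<alpha> - 1)"
    and "ln (\<alpha> / (\<alpha> - 1)) = ln \<alpha> - ln (\<alpha> - 1)"
proof -
  have "\<alpha> / (\<alpha> - 1) - 1 = inverse (\<alpha> - 1)"
    using assms by (simp add: field_simps)
  then show "ln (\<alpha> / (\<alpha> - 1) - 1) = - ln (\<alpha> - 1)"
    using assms by (simp only: ln_inverse)
  show "ln (\<alpha> / (\<alpha> - 1)) = ln \<alpha> - ln (\<alpha> - 1)"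
    using assms by (simp add: ln_div)
qed

lemma kappa_slope_zero:
  assumes "\<alpha> > 1"
  shows "kappa_slope \<alpha> (\<alpha> / (\<alpha> - 1)) = 0"
  unfolding kappa_slope_def ln_peak[OF assms] by (simp add: algebra_simps)

lemma kappa_strict_mono_on:
  assumes "\<alpha> > 1"
  shows "strict_mono_on {1<..\<alpha> / (\<alpha> - 1)} (kappa \<alpha>)"
proof (rule strict_mono_onI)
  fix x y assume xy: "x \<in> {1<..\<alpha> / (\<alpha> - 1)}" "y \<in> {1<..\<alpha> / (\<alpha> - 1)}" "x < y"
  show "kappa \<alpha> x < kappa \<alpha> y"
  proof (rule DERIV_pos_imp_increasing_open[OF \<open>x < y\<close>])
    fix t assume t: "x < t" "t < y"
    then have "kappa_slope \<alpha> t > 0"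
      using kappa_slope_strict_antimono[of \<alpha> t "\<alpha> / (\<alpha> - 1)"] kappa_slope_zero assms xy
      by simp
    then show "\<exists>d. (kappa \<alpha> has_real_derivative d) (at t) \<and> d > 0"
      using kappa_has_real_derivative[of \<alpha> t] geometric_cross_entropy_pos[of \<alpha> t] assms xy t
      by (intro exI[of _ "kappa_slope \<alpha> t / (geometric_cross_entropy \<alpha> t)\<^sup>2"]) simp
  next
    show "continuous_on {x..y} (kappa \<alpha>)"
      using assms xy by (intro continuous_on_kappa) auto
  qed
qed

lemma kappa_strict_antimono_on:
  assumes "\<alpha> > 1"
  shows "strict_antimono_on {\<alpha> / (\<alpha> - 1)..} (kappa \<alpha>)"
proof (rule monotone_onI)
  have c: "\<alpha> / (\<alpha> - 1) > 1"
    using assms by simp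
  fix x y assume xy: "x \<in> {\<alpha> / (\<alpha> - 1)..}" "y \<in> {\<alpha> / (\<alpha> - 1)..}" "x < y"
  have "\<alpha> / (\<alpha> - 1) \<le> x"
    using xy(1) by simp
  with c have x: "x > 1"
    by (rule less_le_trans)
  show "kappa \<alpha> y < kappa \<alpha> x"
  proof (rule DERIV_neg_imp_decreasing_open[OF \<open>x < y\<close>])
    fix t assume t: "x < t" "t < y"
    have c_less: "\<alpha> / (\<alpha> - 1) < t"
      using \<open>\<alpha> / (\<alpha> - 1) \<le> x\<close> t(1) by (rule le_less_trans)
    have "t > 1"
      using x t(1) by (rule less_trans)
    have "kappa_slope \<alpha> t < 0"
      using kappa_slope_strict_antimono[OF assms c c_less] kappa_slope_zero[OF assms]
      by simp
    then show "\<exists>d. (kappa \<alpha> has_real_derivative d) (at t) \<and> d < 0"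
      using kappa_has_real_derivative[of \<alpha> t] geometric_cross_entropy_pos[of \<alpha> t] assms \<open>t > 1\<close>
      by (intro exI[of _ "kappa_slope \<alpha> t / (geometric_cross_entropy \<alpha> t)\<^sup>2"])
        (simp add: divide_neg_pos)
  next
    show "continuous_on {x..y} (kappa \<alpha>)"
      using assms x by (intro continuous_on_kappa) auto
  qed
qed

lemma kappa_le_kappa_peak:
  assumes "\<alpha> > 1" "x > 1"
  shows "kappa \<alpha> x \<le> kappa \<alpha> (\<alpha> / (\<alpha> - 1))"
proof (cases x "\<alpha> / (\<alpha> - 1)" rule: linorder_cases)
  case less
  then show ?thesis
    using strict_mono_onD[OF kappa_strict_mono_on[OF assms(1)], of x "\<alpha> / (\<alpha> - 1)"] assms
    by simp
next
  case greater
  then show ?thesis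
    using monotone_onD[OF kappa_strict_antimono_on[OF assms(1)], of "\<alpha> / (\<alpha> - 1)" x]
    by simp
qed simp

lemma kappa_peak_eq_1:
  assumes "\<alpha> > 1"
  shows "kappa \<alpha> (\<alpha> / (\<alpha> - 1)) = 1"
proof -
  define c where "c = \<alpha> / (\<alpha> - 1)"
  have ln_c: "ln (c - 1) = - ln (\<alpha> - 1)" "ln c = ln \<alpha> - ln (\<alpha> - 1)"
    unfolding c_def by (rule ln_peak[OF assms])+
  have "c > 1"
    using assms by (simp add: c_def)
  have "geometric_entropy c = geometric_cross_entropy \<alpha> c"
    unfolding geometric_entropy_def geometric_cross_entropy_def ln_c
    by (simp add: algebra_simps)
  then have "kappa \<alpha> c = 1"
    using geometric_cross_entropy_pos[of \<alpha> c] assms \<open>c > 1\<close>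
    by (simp add: kappa_eq_entropy_quotient)
  then show ?thesis
    by (simp only: c_def)
qed

lemma kappa_tendsto_at_right_1:
  assumes "\<alpha> > 1"
  shows "(kappa \<alpha> \<longlongrightarrow> 0) (at_right 1)"
proof -
  have N: "(geometric_entropy \<longlongrightarrow> 0) (at_right 1)"
    unfolding geometric_entropy_def[abs_def] by real_asymp
  have D: "(geometric_cross_entropy \<alpha> \<longlongrightarrow> geometric_cross_entropy \<alpha> 1) (at_right 1)"
    unfolding geometric_cross_entropy_def[abs_def] by (intro tendsto_intros)
  show ?thesis
    using tendsto_divide[OF N D] geometric_cross_entropy_pos[of \<alpha> 1] assms
    by (simp add: kappa_eq_entropy_quotient[abs_def])
qed

text \<open>
  Dividing both the entropy and the cross entropy by \<open>x\<close> makes their limits \<open>0\<close> and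
  \<^term>\<open>ln \<alpha>\<close>, with \<open>ln \<alpha> > 0\<close>.
\<close>

lemma kappa_tendsto_at_top:
  assumes "\<alpha> > 1"
  shows "(kappa \<alpha> \<longlongrightarrow> 0) at_top"
proof -
  have N: "((\<lambda>x. geometric_entropy x / x) \<longlongrightarrow> 0) at_top"
    unfolding geometric_entropy_def[abs_def] by real_asymp
  have D: "((\<lambda>x. geometric_cross_entropy \<alpha> x / x) \<longlongrightarrow> ln \<alpha>) at_top"
    unfolding geometric_cross_entropy_def[abs_def] by real_asymp
  have "((\<lambda>x. (geometric_entropy x / x) / (geometric_cross_entropy \<alpha> x / x)) \<longlongrightarrow> 0) at_top"
    using tendsto_divide[OF N D] assms by simp
  moreover have "eventually (\<lambda>x. (geometric_entropy x / x) / (geometric_cross_entropy \<alpha> x / x)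
      = kappa \<alpha> x) at_top"
    using eventually_gt_at_top[of 0]
    by eventually_elim (simp add: kappa_eq_entropy_quotient)
  ultimately show ?thesis
    by (rule Lim_transform_eventually)
qed

theorem corollary2p1:
  fixes \<alpha> :: real
  assumes "\<alpha> > 1"
  shows "(\<forall>x>1. kappa \<alpha> x > 0)
    \<and> kappa \<alpha> differentiable_on {1<..}
    \<and> unimodal (kappa \<alpha>)
    \<and> is_arg_max (kappa \<alpha>) (\<lambda>x. x > 1) (\<alpha> / (\<alpha> - 1))
    \<and> kappa \<alpha> (\<alpha> / (\<alpha> - 1)) = 1
    \<and> (kappa \<alpha> \<longlongrightarrow> 0) (at_right 1)
    \<and> (kappa \<alpha> \<longlongrightarrow> 0) at_top"
proof (intro conjI)
  have c: "\<alpha> / (\<alpha> - 1) > 1"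
    using assms by simp
  show "\<forall>x>1. kappa \<alpha> x > 0"
    using kappa_pos[OF assms] by blast
  show "kappa \<alpha> differentiable_on {1<..}"
    unfolding differentiable_on_def real_differentiable_def
    using kappa_has_real_derivative[OF assms] has_field_derivative_at_within by blast
  show "unimodal (kappa \<alpha>)"
    unfolding unimodal_def
    using c kappa_strict_mono_on[OF assms] kappa_strict_antimono_on[OF assms] by blast
  show "is_arg_max (kappa \<alpha>) (\<lambda>x. x > 1) (\<alpha> / (\<alpha> - 1))"
    unfolding is_arg_max_def
    using c kappa_le_kappa_peak[OF assms] by (blast dest: leD)
  show "kappa \<alpha> (\<alpha> / (\<alpha> - 1)) = 1"
    by (rule kappa_peak_eq_1[OF assms])
  show "(kappa \<alpha> \<longlongrightarrow> 0) (at_right 1)"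
    by (rule kappa_tendsto_at_right_1[OF assms])
  show "(kappa \<alpha> \<longlongrightarrow> 0) at_top"
    by (rule kappa_tendsto_at_top[OF assms])
qed

end
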